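(* Let $\lambda$ be a nonzero real number. For every integer $n\ge0$, \[ B_{n,\lambda}(x)=\sum_{m=0}^{n}J_{m,\lambda}(x)\,S_{1,\lambda}(n,m), \] and in particular $B_{n,\lambda}=\sum_{m=0}^{n}J_{m,\lambda}S_{1,\lambda}(n,m)$.
   Context: For a nonzero real $\lambda$, set $(x)_{0,\lambda}=1$ and $(x)_{n,\lambda}=x(x-\lambda)\cdots(x-(n-1)\lambda)$ for $n\ge1$. Let $e_\lambda^x(t)=\sum_{n\ge0}(x)_{n,\lambda}\frac{t^n}{n!}=(1+\lambda t)^{x/\lambda}$, $e_\lambda(t)=e_\lambda^1(t)$, and $\log_\lambda(1+t)=\frac{1}{\lambda}((1+t)^\lambda-1)$. The degenerate Stirling numbers of the first kind are defined by $\frac{1}{k!}(\log_\lambda(1+t))^k=\sum_{n\ge k}S_{1,\lambda}(n,k)\frac{t^n}{n!}$. The degenerate Bell polynomials are defined by $e_\lambda^x(e_\lambda(t)-1)=\sum_{n\ge0}B_{n,\lambda}(x)\frac{t^n}{n!}$, with $B_{n,\lambda}=B_{n,\lambda}(1)$. The Jindalrae polynomials are defined by $e_\lambda^x\big(e_\lambda(e_\lambda(t)-1)-1\big)=\sum_{n\ge0}J_{n,\lambda}(x)\frac{t^n}{n!}$, with $J_{n,\lambda}=J_{n,\lambda}(1)$. *)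

theory Defs
  imports Complex_Main "HOL-Computational_Algebra.Formal_Power_Series"
begin

text \<open>
  All generating functions are formal power series in \<open>t\<close> over the reals, for fixed real values
  of the parameter \<open>l\<close> (the \<open>\<lambda>\<close> of the literature) and of \<open>x\<close>. An inner
  series substituted by \<open>oo\<close> always has constant term 0.
\<close>

definition deg_falling :: "real \<Rightarrow> real \<Rightarrow> nat \<Rightarrow> real" where
  "deg_falling l x n = (\<Prod>i<n. x - real i * l)"

definition deg_exp :: "real \<Rightarrow> real \<Rightarrow> real fps" where
  "deg_exp l x = Abs_fps (\<lambda>n. deg_falling l x n / fact n)"

text \<open>The series of \<open>log\<^sub>\<lambda>(1 + t) = ((1 + t)\<^sup>\<lambda> - 1) / \<lambda>\<close> in \<open>t\<close>;
  \<open>fps_binomial a\<close> is the series of \<open>(1 + t)\<^sup>a\<close>.\<close>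

definition deg_log :: "real \<Rightarrow> real fps" where
  "deg_log l = fps_const (1 / l) * (fps_binomial l - 1)"

definition deg_Stirling1 :: "real \<Rightarrow> nat \<Rightarrow> nat \<Rightarrow> real" where
  "deg_Stirling1 l n k = fact n * fps_nth (fps_const (1 / fact k) * deg_log l ^ k) n"

definition deg_Bell_poly :: "real \<Rightarrow> nat \<Rightarrow> real \<Rightarrow> real" where
  "deg_Bell_poly l n x = fact n * fps_nth (deg_exp l x oo (deg_exp l 1 - 1)) n"

definition deg_Bell :: "real \<Rightarrow> nat \<Rightarrow> real" where
  "deg_Bell l n = deg_Bell_poly l n 1"

definition Jindalrae_poly :: "real \<Rightarrow> nat \<Rightarrow> real \<Rightarrow> real" where
  "Jindalrae_poly l n x =
     fact n * fps_nth (deg_exp l x oo ((deg_exp l 1 oo (deg_exp l 1 - 1)) - 1)) n"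

definition Jindalrae :: "real \<Rightarrow> nat \<Rightarrow> real" where
  "Jindalrae l n = Jindalrae_poly l n 1"

lemma deg_exp_closed_form:
  assumes "l \<noteq> 0"
  shows "deg_exp l x = fps_binomial (x / l) oo (fps_const l * fps_X)"
proof -
  have *: "deg_falling l x n = l ^ n * (\<Prod>i<n. x / l - real i)" for n
    using assms by (induction n) (simp_all add: deg_falling_def field_simps)
  show ?thesis
    by (simp add: fps_eq_iff deg_exp_def fps_compose_linear *
        gbinomial_prod_rev atLeast0LessThan)
qed

lemma deg_Stirling1_gf:
  "fps_const (1 / fact k) * deg_log l ^ k = Abs_fps (\<lambda>n. deg_Stirling1 l n k / fact n)"
  by (simp add: fps_eq_iff deg_Stirling1_def)

lemma deg_Stirling1_eq_0: "n < k \<Longrightarrow> deg_Stirling1 l n k = 0"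
  using startsby_zero_power_prefix[of "deg_log l" k]
  by (simp add: deg_Stirling1_def deg_log_def)

lemma deg_Bell_poly_gf:
  "deg_exp l x oo (deg_exp l 1 - 1) = Abs_fps (\<lambda>n. deg_Bell_poly l n x / fact n)"
  by (simp add: fps_eq_iff deg_Bell_poly_def)

lemma Jindalrae_poly_gf:
  "deg_exp l x oo ((deg_exp l 1 oo (deg_exp l 1 - 1)) - 1) =
     Abs_fps (\<lambda>n. Jindalrae_poly l n x / fact n)"
  by (simp add: fps_eq_iff Jindalrae_poly_def)

end

theory Submission
  imports Defs
begin

text \<open>
  The series \<open>log\<^sub>\<lambda>(1 + t)\<close> is the compositional inverse of \<open>e\<^sub>\<lambda>(t) - 1\<close>, so substituting it for \<open>t\<close>
  in the generating function of the Jindalrae polynomials removes the innermost exponential and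
  leaves the generating function of the degenerate Bell polynomials. Expanding the substitution
  in powers of \<open>log\<^sub>\<lambda>(1 + t)\<close> produces the Stirling numbers.
\<close>

text \<open>Formally \<open>((1 + t)^b)^a = (1 + t)^(a * b)\<close>. The composite has constant term
  1 and satisfies \<open>(1 + t) * f' = a * b * f\<close>, which determines it.\<close>

lemma fps_binomial_compose:
  fixes a b :: "'a::field_char_0"
  shows "fps_binomial a oo (fps_binomial b - 1) = fps_binomial (a * b)"
proof -
  let ?g = "fps_binomial b - 1"
  let ?i = "inverse (1 + fps_X) :: 'a fps"
  have g0: "fps_nth ?g 0 = 0"
    by simp
  have "(1 + fps_X) oo ?g = fps_binomial b"
    by (simp add: fps_compose_add_distrib)
  then have i_comp: "?i oo ?g = inverse (fps_binomial b)"
    using fps_inverse_compose[OF g0, of "1 + fps_X"] by simp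
  have deriv: "fps_deriv (fps_binomial c) = fps_const c * fps_binomial c * ?i" for c :: 'a
    by (simp add: fps_binomial_deriv fps_divide_unit)
  have cancel: "inverse (fps_binomial b) * fps_binomial b = 1"
    by (simp add: inverse_mult_eq_1)
  \<comment> \<open>Chain rule: the outer derivative contributes
    \<open>inverse (fps_binomial b)\<close>, which cancels the \<open>fps_binomial b\<close> from
    the inner one.\<close>
  have "fps_deriv (fps_binomial a oo ?g)
      = fps_const a * (fps_binomial a oo ?g) * inverse (fps_binomial b)
        * (fps_const b * fps_binomial b * ?i)"
    by (simp add: fps_compose_deriv[OF g0] deriv fps_compose_mult_distrib[OF g0] i_comp)
  also have "\<dots> = (fps_const a * fps_const b) * (fps_binomial a oo ?g)
        * (inverse (fps_binomial b) * fps_binomial b) * ?i"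
    by (simp only: ac_simps)
  also have "\<dots> = fps_const (a * b) * (fps_binomial a oo ?g) / (1 + fps_X)"
    by (simp add: cancel fps_divide_unit)
  finally show ?thesis
    using fps_binomial_ODE_unique'[of "fps_binomial a oo ?g" "a * b"] by simp
qed

lemma deg_log_nth_0 [simp]: "fps_nth (deg_log l) 0 = 0"
  by (simp add: deg_log_def)

lemma deg_exp_nth_0 [simp]: "fps_nth (deg_exp l x) 0 = 1"
  by (simp add: deg_exp_def deg_falling_def)

text \<open>In the closed form of \<open>deg_exp\<close>, the scaling by \<open>l\<close> cancels
  the \<open>1 / l\<close> in \<open>deg_log\<close>; then the exponents \<open>x / l\<close> and
  \<open>l\<close> multiply to \<open>x\<close>.\<close>

lemma deg_exp_compose_deg_log:
  assumes "l \<noteq> 0"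
  shows "deg_exp l x oo deg_log l = fps_binomial x"
proof -
  have "(fps_const l * fps_X) oo deg_log l = fps_const l * deg_log l"
    by (simp add: fps_compose_mult_distrib)
  also have "\<dots> = fps_binomial l - 1"
    using assms by (simp add: deg_log_def mult.assoc[symmetric])
  finally have "deg_exp l x oo deg_log l = fps_binomial (x / l) oo (fps_binomial l - 1)"
    using fps_compose_assoc[of "deg_log l" "fps_const l * fps_X" "fps_binomial (x / l)"]
    by (simp add: deg_exp_closed_form[OF assms])
  then show ?thesis
    using assms by (simp add: fps_binomial_compose)
qed

lemma Jindalrae_gf_compose_deg_log:
  assumes "l \<noteq> 0"
  shows "(deg_exp l x oo ((deg_exp l 1 oo (deg_exp l 1 - 1)) - 1)) oo deg_log l
       = deg_exp l x oo (deg_exp l 1 - 1)"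
proof -
  \<comment> \<open>At \<open>x = 1\<close> the composite is \<open>fps_binomial 1\<close>, that is
    \<open>1 + fps_X\<close>.\<close>
  have "(deg_exp l 1 - 1) oo deg_log l = fps_X"
    by (simp add: fps_compose_sub_distrib deg_exp_compose_deg_log[OF assms] fps_binomial_1)
  then have "((deg_exp l 1 oo (deg_exp l 1 - 1)) - 1) oo deg_log l = deg_exp l 1 - 1"
    by (simp add: fps_compose_sub_distrib fps_compose_assoc[symmetric])
  then show ?thesis
    by (simp add: fps_compose_assoc[symmetric])
qed

text \<open>The factor \<open>fact m\<close> cancels the \<open>1 / fact m\<close> in
  \<open>deg_Stirling1\<close>. Arbitrary \<open>f\<close> makes this a transform of exponential
  coefficients.\<close>

lemma fps_compose_deg_log_nth:
  "fact n * fps_nth (f oo deg_log l) n = (\<Sum>m=0..n. (fact m * fps_nth f m) * deg_Stirling1 l n m)"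
  by (simp add: fps_compose_nth deg_Stirling1_def sum_distrib_left ac_simps)

theorem theorem9:
  fixes l :: real and n :: nat
  assumes "l \<noteq> 0"
  shows "(\<forall>x::real. deg_Bell_poly l n x = (\<Sum>m=0..n. Jindalrae_poly l m x * deg_Stirling1 l n m)) \<and>
         deg_Bell l n = (\<Sum>m=0..n. Jindalrae l m * deg_Stirling1 l n m)"
proof -
  have "deg_Bell_poly l n x = (\<Sum>m=0..n. Jindalrae_poly l m x * deg_Stirling1 l n m)" for x
    unfolding deg_Bell_poly_def Jindalrae_poly_def
    \<comment> \<open>The transform is read from right to left, with \<open>f\<close> the Jindalrae
      generating function.\<close>
    by (simp only: fps_compose_deg_log_nth[symmetric] Jindalrae_gf_compose_deg_log[OF assms])
  then show ?thesis
    by (simp add: deg_Bell_def Jindalrae_def)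
qed

end
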